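(* Let $G$ be a bounded abelian group and let $\tau$ be a locally quasi-convex group topology on $G$ which is not precompact. Then $|(G,\tau)^\wedge|\ge\mathfrak{c}$.
   Context: $\mathfrak{c}$ is the cardinality of the continuum. $\mathbb{T}$ is the unit circle group in $\mathbb{C}$ and $\mathbb{T}_+=\{z\in\mathbb{T}:\mathrm{Re}(z)\ge 0\}$. An abelian group $G$ is bounded if there is a positive integer $m$ with $mG=\{0\}$. For a topological abelian group $(G,\tau)$, the dual group $(G,\tau)^\wedge$ is the group of all continuous homomorphisms $(G,\tau)\to\mathbb{T}$. A subset $M\subseteq G$ is quasi-convex if for every $x\in G\setminus M$ there is $\phi\in (G,\tau)^\wedge$ with $\phi(M)\subseteq\mathbb{T}_+$ and $\phi(x)\notin\mathbb{T}_+$. The topology $\tau$ is locally quasi-convex if it has a basis of neighborhoods of $0$ consisting of quasi-convex sets; locally quasi-convex group topologies are taken to be Hausdorff. A group topology is precompact if for every neighborhood $U$ of $0$ there is a finite $F\subseteq G$ with $F+U=G$. *)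

theory Defs
  imports "HOL-Analysis.Analysis" "HOL-Algebra.Coset"
begin

text \<open>Groups are the (multiplicatively written) groups of HOL-Algebra, so \<open>m G = {0}\<close> becomes
  \<open>x [^] m = \<one>\<close> for all \<open>x\<close>, and \<open>F + U\<close> becomes \<open>F <#> U\<close>.\<close>

definition bounded_group :: "('a, 'b) monoid_scheme \<Rightarrow> bool" where
  "bounded_group G \<longleftrightarrow>
     (\<exists>m::nat. m > 0 \<and> (\<lambda>x. x [^]\<^bsub>G\<^esub> m) ` carrier G = {\<one>\<^bsub>G\<^esub>})"

definition group_topology :: "('a, 'b) monoid_scheme \<Rightarrow> 'a topology \<Rightarrow> bool" where
  "group_topology G \<tau> \<longleftrightarrow>
     topspace \<tau> = carrier G \<and>
     continuous_map (prod_topology \<tau> \<tau>) \<tau> (\<lambda>(x, y). x \<otimes>\<^bsub>G\<^esub> y) \<and>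
     continuous_map \<tau> \<tau> (\<lambda>x. inv\<^bsub>G\<^esub> x)"

definition circle_group :: "complex monoid" where
  "circle_group = \<lparr>carrier = sphere 0 1, mult = (*), one = 1\<rparr>"

definition circle_plus :: "complex set" where
  "circle_plus = {z \<in> carrier circle_group. Re z \<ge> 0}"

text \<open>HOL-Algebra homomorphisms are unconstrained outside the carrier. Characters are made
  extensional, so that distinct elements of the dual differ at some point of the group and the
  cardinality of the dual is the intended one.\<close>

definition dual_group :: "('a, 'b) monoid_scheme \<Rightarrow> 'a topology \<Rightarrow> ('a \<Rightarrow> complex) monoid" where
  "dual_group G \<tau> =
     \<lparr>carrier = {\<phi> \<in> hom G circle_group \<inter> extensional (carrier G).
                   continuous_map \<tau> (top_of_set (carrier circle_group)) \<phi>},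
      mult = (\<lambda>\<phi> \<psi>. \<lambda>x\<in>carrier G. \<phi> x * \<psi> x),
      one = (\<lambda>x\<in>carrier G. 1)\<rparr>"

definition quasi_convex :: "('a, 'b) monoid_scheme \<Rightarrow> 'a topology \<Rightarrow> 'a set \<Rightarrow> bool" where
  "quasi_convex G \<tau> M \<longleftrightarrow>
     M \<subseteq> carrier G \<and>
     (\<forall>x \<in> carrier G - M. \<exists>\<phi> \<in> carrier (dual_group G \<tau>).
        \<phi> ` M \<subseteq> circle_plus \<and> \<phi> x \<notin> circle_plus)"

definition locally_quasi_convex :: "('a, 'b) monoid_scheme \<Rightarrow> 'a topology \<Rightarrow> bool" where
  "locally_quasi_convex G \<tau> \<longleftrightarrow>
     group_topology G \<tau> \<and> Hausdorff_space \<tau> \<and>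
     neighbourhood_base_at \<one>\<^bsub>G\<^esub> (quasi_convex G \<tau>) \<tau>"

definition precompact :: "('a, 'b) monoid_scheme \<Rightarrow> 'a topology \<Rightarrow> bool" where
  "precompact G \<tau> \<longleftrightarrow>
     (\<forall>U \<subseteq> carrier G. (\<exists>V. openin \<tau> V \<and> \<one>\<^bsub>G\<^esub> \<in> V \<and> V \<subseteq> U) \<longrightarrow>
        (\<exists>F. finite F \<and> F \<subseteq> carrier G \<and> F <#>\<^bsub>G\<^esub> U = carrier G))"

end

theory Submission
  imports Defs
begin

text \<open>A quasi-convex neighbourhood \<open>M\<close> of \<open>\<one>\<close> witnessing non-precompactness has an infinite polar
  \<open>P\<close>: the common kernel of \<open>P\<close> lies in \<open>M\<close>, and characters of \<open>G\<close> take finitely many values, so for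
  finite \<open>P\<close> finitely many translates of \<open>M\<close> would cover \<open>G\<close>. If \<open>x\<close> is so close to \<open>\<one>\<close> that all its
  powers are in \<open>M\<close>, then \<open>\<phi> x\<close> generates a subgroup of \<open>\<T>\<^sub>+\<close> for every \<open>\<phi> \<in> P\<close>, hence
  \<open>\<phi> x = 1\<close>. So \<open>P\<close> is contained in the set \<open>S\<close> of characters that are trivial on a fixed
  neighbourhood \<open>W\<close> of \<open>\<one>\<close>. All elements of \<open>S\<close> are continuous, and \<open>S\<close> is compact for pointwise
  convergence. By pigeonhole, for every finite set there are distinct elements of \<open>P\<close> that agree on
  it, and multiplying with their quotient shows that \<open>S\<close> has no isolated points. A nonempty perfect
  compact Hausdorff space has at least continuum many points.\<close>

section \<open>The circle group and roots of unity\<close>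

lemma circle_group_simps [simp]:
  "carrier circle_group = sphere 0 1" "x \<otimes>\<^bsub>circle_group\<^esub> y = x * y" "\<one>\<^bsub>circle_group\<^esub> = 1"
  by (simp_all add: circle_group_def)

lemma group_circle_group: "group circle_group"
proof (rule groupI)
  fix x assume "x \<in> carrier circle_group"
  then show "\<exists>y\<in>carrier circle_group. y \<otimes>\<^bsub>circle_group\<^esub> x = \<one>\<^bsub>circle_group\<^esub>"
    by (intro bexI[of _ "inverse x"]) (auto simp: norm_inverse intro!: left_inverse)
qed (auto simp: norm_mult)

lemma nat_pow_circle_group [simp]: "x [^]\<^bsub>circle_group\<^esub> (n::nat) = x ^ n"
  by (induction n) (auto simp: nat_pow_def)

lemma group_hom_circle:
  assumes "group G" "\<phi> \<in> hom G circle_group"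
  shows "group_hom G circle_group \<phi>"
  using assms group_circle_group by (simp add: group_hom_def group_hom_axioms_def)

text \<open>If \<open>z\<close> were not 1, the powers \<open>z ^ k\<close> with
  \<open>k < m\<close> would sum to 0; but their real parts are nonnegative and \<open>k = 0\<close>
  already contributes 1.\<close>

lemma root_of_unity_eq_1:
  fixes z :: complex
  assumes "m > 0" "z ^ m = 1" "\<And>k. k < m \<Longrightarrow> Re (z ^ k) \<ge> 0"
  shows "z = 1"
proof (rule ccontr)
  assume "z \<noteq> 1"
  then have "(\<Sum>k<m. z ^ k) = 0"
    using assms(2) by (simp add: geometric_sum)
  then have "(\<Sum>k<m. Re (z ^ k)) = 0"
    by (metis Re_sum zero_complex.sel(1))
  moreover have "(\<Sum>k<m. Re (z ^ k)) \<ge> Re (z ^ 0)"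
    by (rule member_le_sum) (use assms in auto)
  ultimately show False by simp
qed

section \<open>Characters trivial on a neighbourhood\<close>

text \<open>Continuity is left out on purpose: what remains are pointwise equations, which define a
  closed subset of the product of circles.\<close>

definition annihilator :: "('a, 'b) monoid_scheme \<Rightarrow> 'a set \<Rightarrow> ('a \<Rightarrow> complex) set" where
  "annihilator G W = {\<phi> \<in> hom G circle_group \<inter> extensional (carrier G). \<forall>x\<in>W. \<phi> x = 1}"

text \<open>A homomorphism trivial on \<open>W\<close> is constant on each translate of
  \<open>W\<close>, hence locally constant, so the preimage of every set \<open>U\<close> is
  open.\<close>

lemma annihilator_subset_dual_group:
  assumes "group G" "group_topology G \<tau>" "openin \<tau> W" "\<one>\<^bsub>G\<^esub> \<in> W"
  shows "annihilator G W \<subseteq> carrier (dual_group G \<tau>)"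
proof
  interpret group G by fact
  fix \<phi> assume "\<phi> \<in> annihilator G W"
  then have hom: "\<phi> \<in> hom G circle_group" and ext: "\<phi> \<in> extensional (carrier G)"
    and triv: "\<And>x. x \<in> W \<Longrightarrow> \<phi> x = 1"
    by (auto simp: annihilator_def)
  have top: "topspace \<tau> = carrier G"
    and mult: "continuous_map (prod_topology \<tau> \<tau>) \<tau> (\<lambda>(x, y). x \<otimes>\<^bsub>G\<^esub> y)"
    using assms(2) by (auto simp: group_topology_def)
  have "openin \<tau> {x \<in> topspace \<tau>. \<phi> x \<in> U}" for U
  proof (subst openin_subopen, intro ballI)
    fix a assume a: "a \<in> {x \<in> topspace \<tau>. \<phi> x \<in> U}"
    \<comment> \<open>This is the translate of \<open>W\<close> by \<open>a\<close>, written as a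
      preimage so that its openness follows from continuity of multiplication.\<close>
    let ?N = "{x \<in> topspace \<tau>. inv\<^bsub>G\<^esub> a \<otimes>\<^bsub>G\<^esub> x \<in> W}"
    have "continuous_map \<tau> \<tau> ((\<lambda>(x, y). x \<otimes>\<^bsub>G\<^esub> y) \<circ> (\<lambda>x. (inv\<^bsub>G\<^esub> a, x)))"
      by (rule continuous_map_compose[OF _ mult])
        (use a top in \<open>auto simp: continuous_map_paired\<close>)
    then have "continuous_map \<tau> \<tau> (\<lambda>x. inv\<^bsub>G\<^esub> a \<otimes>\<^bsub>G\<^esub> x)"
      by (simp add: o_def)
    then have "openin \<tau> ?N"
      using assms(3) by (rule openin_continuous_map_preimage)
    moreover have "a \<in> ?N"
      using a top assms(4) by auto
    moreover have "\<phi> x \<in> U" if "x \<in> ?N" for x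
    proof -
      have "\<phi> x = \<phi> (a \<otimes>\<^bsub>G\<^esub> (inv\<^bsub>G\<^esub> a \<otimes>\<^bsub>G\<^esub> x))"
        using that a top by (simp add: m_assoc[symmetric])
      also have "\<dots> = \<phi> a * \<phi> (inv\<^bsub>G\<^esub> a \<otimes>\<^bsub>G\<^esub> x)"
        using hom_mult[OF hom] that a top by simp
      finally show ?thesis
        using that a triv by simp
    qed
    ultimately show "\<exists>T. openin \<tau> T \<and> a \<in> T \<and> T \<subseteq> {x \<in> topspace \<tau>. \<phi> x \<in> U}"
      by (intro exI[of _ ?N]) blast
  qed
  moreover have "\<phi> \<in> topspace \<tau> \<rightarrow> sphere 0 1"
    using hom top by (auto simp: hom_def)
  ultimately show "\<phi> \<in> carrier (dual_group G \<tau>)"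
    using hom ext by (auto simp: dual_group_def continuous_map_def)
qed

text \<open>Each condition, multiplicativity at one pair or value 1 at one point of
  \<open>W\<close>, equates two continuous functions of finitely many coordinates.\<close>

lemma closedin_annihilator:
  assumes "group G" "W \<subseteq> carrier G"
  shows "closedin (product_topology (\<lambda>_. top_of_set (sphere 0 1)) (carrier G)) (annihilator G W)"
    (is "closedin ?T _")
proof -
  interpret group G by fact
  have coord: "continuous_map ?T euclidean (\<lambda>\<theta>. \<theta> x)" if "x \<in> carrier G" for x
    using continuous_map_product_projection[OF that, of "\<lambda>_. top_of_set (sphere (0::complex) 1)"]
    by (simp add: continuous_map_in_subtopology)
  define D where "D = (\<lambda>(x, y). {\<theta> \<in> topspace ?T. \<theta> (x \<otimes>\<^bsub>G\<^esub> y) = \<theta> x * \<theta> y})"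
  define E where "E = (\<lambda>x. {\<theta> \<in> topspace ?T. \<theta> x = 1})"
  have "closedin ?T (D (x, y))" if xy: "x \<in> carrier G" "y \<in> carrier G" for x y
  proof -
    have "continuous_map ?T euclidean (\<lambda>\<theta>. \<theta> x * \<theta> y)"
      using coord[OF xy(1)] coord[OF xy(2)] by (simp add: continuous_map_atin tendsto_mult)
    then show ?thesis
      unfolding D_def prod.case using xy
      by (intro closedin_continuous_maps_eq[of euclidean] coord) auto
  qed
  moreover have "closedin ?T (E x)" if "x \<in> W" for x
    unfolding E_def using that assms(2)
    by (intro closedin_continuous_maps_eq[of euclidean] coord) auto
  \<comment> \<open>Inserting the whole space makes the family visibly nonempty, as
    \<open>closedin_Inter\<close> requires.\<close>
  ultimately have "closedin ?T (\<Inter> (insert (topspace ?T) (D ` (carrier G \<times> carrier G) \<union> E ` W)))"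
    by (intro closedin_Inter) (auto simp del: topspace_product_topology)
  also have "\<Inter> (insert (topspace ?T) (D ` (carrier G \<times> carrier G) \<union> E ` W)) = annihilator G W"
    by (auto simp: D_def E_def annihilator_def hom_def PiE_def Pi_def)
  finally show ?thesis .
qed

section \<open>Bounded exponent: finitely many values and perfect sets of characters\<close>

lemma character_root_of_unity:
  assumes "group G" "\<phi> \<in> hom G circle_group" "x \<in> carrier G" "x [^]\<^bsub>G\<^esub> m = \<one>\<^bsub>G\<^esub>"
  shows "\<phi> x ^ m = 1"
  using group_hom.hom_nat_pow[OF group_hom_circle[OF assms(1,2)] assms(3), of m]
    group_hom.hom_one[OF group_hom_circle[OF assms(1,2)]] assms(4) by simp

lemma finite_character_values:
  fixes m :: nat
  assumes "group G" "m > 0" "\<And>x. x \<in> carrier G \<Longrightarrow> x [^]\<^bsub>G\<^esub> m = \<one>\<^bsub>G\<^esub>"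
  shows "finite (\<Union>\<phi> \<in> hom G circle_group. \<phi> ` carrier G)"
proof (rule finite_subset)
  show "(\<Union>\<phi> \<in> hom G circle_group. \<phi> ` carrier G) \<subseteq> {z. z ^ m = 1}"
    using character_root_of_unity[OF assms(1)] assms(3) by blast
  show "finite {z::complex. z ^ m = 1}"
    using assms(2) by (simp add: finite_roots_unity)
qed

lemma annihilator_perfect:
  fixes m :: nat
  assumes "group G" "m > 0" "\<And>x. x \<in> carrier G \<Longrightarrow> x [^]\<^bsub>G\<^esub> m = \<one>\<^bsub>G\<^esub>"
    and "W \<subseteq> carrier G" "infinite (annihilator G W)"
  shows "product_topology (\<lambda>_. top_of_set (sphere 0 1)) (carrier G) derived_set_of annihilator G W
    = annihilator G W" (is "?T derived_set_of ?S = ?S")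
proof
  show "?T derived_set_of ?S \<subseteq> ?S"
    using closedin_annihilator[OF assms(1,4)] by (simp add: closedin_contains_derived_set)
  show "?S \<subseteq> ?T derived_set_of ?S"
  proof
    fix \<theta> assume \<theta>: "\<theta> \<in> ?S"
    have "\<exists>\<eta>. \<eta> \<noteq> \<theta> \<and> \<eta> \<in> ?S \<and> \<eta> \<in> N" if N: "\<theta> \<in> N" "openin ?T N" for N
    proof -
      obtain U where U: "finite {x \<in> carrier G. U x \<noteq> sphere 0 1}" "\<theta> \<in> Pi\<^sub>E (carrier G) U"
          "Pi\<^sub>E (carrier G) U \<subseteq> N"
        using openin_product_topology_alt[THEN iffD1, OF N(2), rule_format, OF N(1)]
        by (auto simp del: PiE_iff)
      \<comment> \<open>The box \<open>Pi\<^sub>E (carrier G) U\<close> constrains only the finitely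
        many coordinates in \<open>F\<close>; a character agreeing with \<open>\<theta>\<close> on
        \<open>F\<close> lies in it.\<close>
      define F where "F = {x \<in> carrier G. U x \<noteq> sphere 0 1}"
      let ?V = "\<Union>\<phi> \<in> hom G circle_group. \<phi> ` carrier G"
      have "(\<lambda>\<phi>. restrict \<phi> F) ` ?S \<subseteq> F \<rightarrow>\<^sub>E ?V"
      proof (intro image_subsetI restrict_PiE_iff[THEN iffD2] ballI)
        fix \<phi> x assume "\<phi> \<in> ?S" "x \<in> F"
        then have "\<phi> \<in> hom G circle_group" "x \<in> carrier G"
          by (simp_all add: annihilator_def F_def)
        then show "\<phi> x \<in> ?V"
          by (auto intro!: UN_I[of \<phi>])
      qed
      moreover have "finite (F \<rightarrow>\<^sub>E ?V)"
        using finite_character_values[OF assms(1-3)] U(1) by (intro finite_PiE) (simp_all add: F_def)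
      ultimately have "finite ((\<lambda>\<phi>. restrict \<phi> F) ` ?S)"
        by (rule finite_subset)
      then obtain \<phi> where \<phi>: "\<phi> \<in> ?S" "infinite {\<psi> \<in> ?S. restrict \<psi> F = restrict \<phi> F}"
        using pigeonhole_infinite[OF assms(5)] by blast
      from \<phi>(2) have "{\<psi> \<in> ?S. restrict \<psi> F = restrict \<phi> F} - {\<phi>} \<noteq> {}"
        by (intro infinite_imp_nonempty) simp
      then obtain \<psi> where \<psi>: "\<psi> \<in> ?S" "restrict \<psi> F = restrict \<phi> F" "\<psi> \<noteq> \<phi>"
        by blast
      have agree: "\<psi> x = \<phi> x" if "x \<in> F" for x
        using \<psi>(2) that by (metis restrict_apply')
      have norm1: "norm (\<theta> x) = 1" "norm (\<phi> x) = 1" "norm (\<psi> x) = 1" if "x \<in> carrier G" for x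
        using that \<theta> \<phi>(1) \<psi>(1) by (auto simp: annihilator_def hom_def Pi_def)
      have nz: "\<theta> x \<noteq> 0" "\<phi> x \<noteq> 0" "\<psi> x \<noteq> 0" if "x \<in> carrier G" for x
        using norm1[OF that] by auto
      \<comment> \<open>The quotient of \<open>\<phi>\<close> and \<open>\<psi>\<close> is 1 on
        \<open>F\<close> and on \<open>W\<close> but not everywhere, so this moves
        \<open>\<theta>\<close> inside the box and inside \<open>?S\<close>.\<close>
      define \<eta> where "\<eta> = (\<lambda>x\<in>carrier G. \<theta> x * \<phi> x / \<psi> x)"
      have mult: "\<xi> (x \<otimes>\<^bsub>G\<^esub> y) = \<xi> x * \<xi> y"
        if "\<xi> \<in> ?S" "x \<in> carrier G" "y \<in> carrier G" for \<xi> x y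
        using that by (simp add: annihilator_def hom_def)
      have "\<eta> \<in> hom G circle_group"
      proof (rule homI)
        fix x y assume xy: "x \<in> carrier G" "y \<in> carrier G"
        then have "x \<otimes>\<^bsub>G\<^esub> y \<in> carrier G"
          using group.is_monoid[OF assms(1)] by (intro monoid.m_closed)
        with xy show "\<eta> (x \<otimes>\<^bsub>G\<^esub> y) = \<eta> x \<otimes>\<^bsub>circle_group\<^esub> \<eta> y"
          by (simp add: \<eta>_def mult \<theta> \<phi>(1) \<psi>(1))
      qed (simp add: \<eta>_def norm_mult norm_divide norm1)
      moreover have "\<eta> x = 1" if "x \<in> W" for x
        using that \<theta> \<phi>(1) \<psi>(1) assms(4) by (auto simp: annihilator_def \<eta>_def)
      ultimately have "\<eta> \<in> ?S"
        by (simp add: annihilator_def \<eta>_def)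
      moreover obtain x where "x \<in> carrier G" "\<phi> x \<noteq> \<psi> x"
        using extensionalityI[of \<phi> "carrier G" \<psi>] \<phi>(1) \<psi>(1,3)
        by (auto simp: annihilator_def)
      then have "\<eta> x \<noteq> \<theta> x"
        using nz by (simp add: \<eta>_def field_simps)
      then have "\<eta> \<noteq> \<theta>" by auto
      moreover have "\<eta> \<in> Pi\<^sub>E (carrier G) U"
      proof (rule PiE_I)
        fix x assume x: "x \<in> carrier G"
        show "\<eta> x \<in> U x"
        proof (cases "x \<in> F")
          case True
          then show ?thesis
            using U(2) x nz by (auto simp: \<eta>_def agree)
        next
          case False
          then show ?thesis
            using x by (simp add: F_def \<eta>_def norm_mult norm_divide norm1)
        qed
      qed (simp add: \<eta>_def)
      ultimately show ?thesis using U(3) by blast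
    qed
    moreover have "\<theta> \<in> topspace ?T"
      using \<theta> closedin_subset[OF closedin_annihilator[OF assms(1,4)]] by blast
    ultimately show "\<theta> \<in> ?T derived_set_of ?S"
      by (auto simp: in_derived_set_of)
  qed
qed

text \<open>The product of circles is compact Hausdorff however large \<open>G\<close> is, so the
  locally compact case of \<open>lepoll_perfect_set\<close> applies.\<close>

lemma reals_lepoll_annihilator:
  fixes m :: nat
  assumes "group G" "m > 0" "\<And>x. x \<in> carrier G \<Longrightarrow> x [^]\<^bsub>G\<^esub> m = \<one>\<^bsub>G\<^esub>"
    and "W \<subseteq> carrier G" "infinite (annihilator G W)"
  shows "(UNIV :: real set) \<lesssim> annihilator G W"
proof (rule lepoll_perfect_set)
  let ?T = "product_topology (\<lambda>_. top_of_set (sphere (0::complex) 1)) (carrier G)"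
  have "compact_space ?T"
    by (simp add: compact_space_product_topology compact_space_subtopology)
  moreover have "Hausdorff_space ?T"
    by (simp add: Hausdorff_space_product_topology Hausdorff_space_subtopology)
  ultimately show "completely_metrizable_space ?T \<or> locally_compact_space ?T \<and> Hausdorff_space ?T"
    by (simp add: compact_imp_locally_compact_space)
  show "?T derived_set_of annihilator G W = annihilator G W"
    by (rule annihilator_perfect[OF assms])
  show "annihilator G W \<noteq> {}"
    using assms(5) by auto
qed

section \<open>Power maps and polars of quasi-convex sets\<close>

lemma continuous_map_nat_pow:
  assumes "group G" "group_topology G \<tau>"
  shows "continuous_map \<tau> \<tau> (\<lambda>x. x [^]\<^bsub>G\<^esub> (n::nat))"
proof (induction n)
  case 0
  then show ?case
    using assms by (simp add: group_topology_def group.is_monoid monoid.one_closed)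
next
  case (Suc n)
  have "continuous_map \<tau> \<tau> ((\<lambda>(x, y). x \<otimes>\<^bsub>G\<^esub> y) \<circ> (\<lambda>x. (x [^]\<^bsub>G\<^esub> n, x)))"
    using assms Suc
    by (intro continuous_map_compose[of _ "prod_topology \<tau> \<tau>"])
      (auto simp: group_topology_def continuous_map_paired)
  then show ?case by (simp add: o_def)
qed

text \<open>Quasi-convexity of \<open>M\<close> says that \<open>M\<close> consists of exactly those
  points of \<open>G\<close> that every element of this set sends into
  \<open>circle_plus\<close>.\<close>

definition polar :: "('a, 'b) monoid_scheme \<Rightarrow> 'a topology \<Rightarrow> 'a set \<Rightarrow> ('a \<Rightarrow> complex) set" where
  "polar G \<tau> M = {\<phi> \<in> carrier (dual_group G \<tau>). \<phi> ` M \<subseteq> circle_plus}"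

text \<open>With finitely many characters of finitely many values, joint evaluation has finitely
  many fibres, each inside a translate of the common kernel and so of \<open>M\<close>.\<close>

lemma infinite_polar:
  fixes m :: nat
  assumes "group G" "m > 0" "\<And>x. x \<in> carrier G \<Longrightarrow> x [^]\<^bsub>G\<^esub> m = \<one>\<^bsub>G\<^esub>"
    and "quasi_convex G \<tau> M"
    and no_cover: "\<And>F. finite F \<Longrightarrow> F \<subseteq> carrier G \<Longrightarrow> F <#>\<^bsub>G\<^esub> M \<noteq> carrier G"
  shows "infinite (polar G \<tau> M)"
proof
  interpret group G by fact
  assume fin: "finite (polar G \<tau> M)"
  have hom: "\<phi> \<in> hom G circle_group" if "\<phi> \<in> polar G \<tau> M" for \<phi>
    using that by (simp add: polar_def dual_group_def)
  have M: "M \<subseteq> carrier G"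
    using assms(4) by (simp add: quasi_convex_def)
  have ker: "x \<in> M" if "x \<in> carrier G" "\<And>\<phi>. \<phi> \<in> polar G \<tau> M \<Longrightarrow> \<phi> x = 1" for x
  proof (rule ccontr)
    assume "x \<notin> M"
    then obtain \<phi> where "\<phi> \<in> polar G \<tau> M" "\<phi> x \<notin> circle_plus"
      using assms(4) \<open>x \<in> carrier G\<close> unfolding quasi_convex_def polar_def by blast
    then show False
      using that(2)[of \<phi>] by (simp add: circle_plus_def)
  qed
  let ?V = "\<Union>\<phi> \<in> hom G circle_group. \<phi> ` carrier G"
  define ev where "ev = (\<lambda>x. \<lambda>\<phi>\<in>polar G \<tau> M. \<phi> x)"
  have "ev ` carrier G \<subseteq> polar G \<tau> M \<rightarrow>\<^sub>E ?V"
    by (auto simp: ev_def intro!: bexI[OF _ hom])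
  moreover have "finite (polar G \<tau> M \<rightarrow>\<^sub>E ?V)"
    using finite_character_values[OF assms(1-3)] fin by (intro finite_PiE)
  ultimately have "finite (ev ` carrier G)"
    by (rule finite_subset)
  \<comment> \<open>\<open>F\<close> picks representatives for the fibres of \<open>ev\<close>; its
    translates of \<open>M\<close> will cover \<open>G\<close>.\<close>
  then obtain F where F: "F \<subseteq> carrier G" "finite F" "ev ` carrier G = ev ` F"
    using finite_subset_image[of "ev ` carrier G" ev "carrier G"] by auto
  have "g \<in> F <#>\<^bsub>G\<^esub> M" if g: "g \<in> carrier G" for g
  proof -
    obtain f where f: "f \<in> F" "ev g = ev f"
      using F(3) g by (metis imageE imageI)
    then have fG: "f \<in> carrier G" using F(1) by auto
    have "inv\<^bsub>G\<^esub> f \<otimes>\<^bsub>G\<^esub> g \<in> M"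
    proof (rule ker)
      fix \<phi> assume \<phi>: "\<phi> \<in> polar G \<tau> M"
      then have "\<phi> g = \<phi> f"
        using f(2) unfolding ev_def by (metis restrict_apply')
      then have "\<phi> (inv\<^bsub>G\<^esub> f \<otimes>\<^bsub>G\<^esub> g) = \<phi> (inv\<^bsub>G\<^esub> f) * \<phi> f"
        using hom_mult[OF hom[OF \<phi>], of "inv\<^bsub>G\<^esub> f" g] fG g by simp
      also have "\<dots> = \<phi> (inv\<^bsub>G\<^esub> f \<otimes>\<^bsub>G\<^esub> f)"
        using hom_mult[OF hom[OF \<phi>], of "inv\<^bsub>G\<^esub> f" f] fG by simp
      also have "\<dots> = 1"
        using fG group_hom.hom_one[OF group_hom_circle[OF assms(1) hom[OF \<phi>]]] by simp
      finally show "\<phi> (inv\<^bsub>G\<^esub> f \<otimes>\<^bsub>G\<^esub> g) = 1" .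
    qed (use fG g in simp)
    moreover have "g = f \<otimes>\<^bsub>G\<^esub> (inv\<^bsub>G\<^esub> f \<otimes>\<^bsub>G\<^esub> g)"
      using fG g by (simp add: m_assoc[symmetric])
    ultimately show ?thesis
      using f(1) by (auto simp: set_mult_def)
  qed
  moreover have "F <#>\<^bsub>G\<^esub> M \<subseteq> carrier G"
    by (rule set_mult_closed[OF F(1) M])
  ultimately show False
    using no_cover[OF F(2,1)] by blast
qed

text \<open>For \<open>x\<close> in \<open>W\<close>, \<open>\<phi> x\<close> is an
  \<open>m\<close>-th root of unity with all powers in the right half circle, so
  \<open>root_of_unity_eq_1\<close> applies.\<close>

lemma polar_subset_annihilator:
  fixes m :: nat
  assumes "group G" "m > 0" "\<And>x. x \<in> carrier G \<Longrightarrow> x [^]\<^bsub>G\<^esub> m = \<one>\<^bsub>G\<^esub>"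
    and "W \<subseteq> carrier G" "\<And>x k. x \<in> W \<Longrightarrow> k < m \<Longrightarrow> x [^]\<^bsub>G\<^esub> k \<in> M"
  shows "polar G \<tau> M \<subseteq> annihilator G W"
proof
  fix \<phi> assume \<phi>: "\<phi> \<in> polar G \<tau> M"
  then have hom: "\<phi> \<in> hom G circle_group" and ext: "\<phi> \<in> extensional (carrier G)"
    and pos: "\<And>x. x \<in> M \<Longrightarrow> Re (\<phi> x) \<ge> 0"
    by (auto simp: polar_def dual_group_def circle_plus_def)
  have "\<phi> x = 1" if "x \<in> W" for x
  proof (rule root_of_unity_eq_1[OF assms(2)])
    have x: "x \<in> carrier G" using that assms(4) by auto
    then show "\<phi> x ^ m = 1"
      by (intro character_root_of_unity[OF assms(1) hom] assms(3))
    show "Re (\<phi> x ^ k) \<ge> 0" if "k < m" for k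
      using pos[OF assms(5)[OF \<open>x \<in> W\<close> that]]
        group_hom.hom_nat_pow[OF group_hom_circle[OF assms(1) hom] x, of k] by simp
  qed
  then show "\<phi> \<in> annihilator G W"
    using hom ext by (simp add: annihilator_def)
qed

theorem corollary1p11:
  fixes G :: "('a, 'b) monoid_scheme" and \<tau> :: "'a topology"
  assumes "comm_group G"
    and "bounded_group G"
    and "locally_quasi_convex G \<tau>"
    and "\<not> precompact G \<tau>"
  shows "(UNIV :: real set) \<lesssim> carrier (dual_group G \<tau>)"
proof -
  interpret comm_group G by fact
  have G: "group G" by (rule is_group)
  obtain m :: nat where m: "m > 0" and exp: "\<And>x. x \<in> carrier G \<Longrightarrow> x [^]\<^bsub>G\<^esub> m = \<one>\<^bsub>G\<^esub>"
    using assms(2) by (auto simp: bounded_group_def)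
  have gt: "group_topology G \<tau>" and nb: "neighbourhood_base_at \<one>\<^bsub>G\<^esub> (quasi_convex G \<tau>) \<tau>"
    using assms(3) by (auto simp: locally_quasi_convex_def)
  have top: "topspace \<tau> = carrier G"
    using gt by (simp add: group_topology_def)
  obtain U V where U: "U \<subseteq> carrier G" "openin \<tau> V" "\<one>\<^bsub>G\<^esub> \<in> V" "V \<subseteq> U"
      and no_cover: "\<And>F. finite F \<Longrightarrow> F \<subseteq> carrier G \<Longrightarrow> F <#>\<^bsub>G\<^esub> U \<noteq> carrier G"
    using assms(4) by (auto simp: precompact_def)
  obtain V' M where M: "openin \<tau> V'" "quasi_convex G \<tau> M" "\<one>\<^bsub>G\<^esub> \<in> V'" "V' \<subseteq> M" "M \<subseteq> V"
    using nb U(2,3) unfolding neighbourhood_base_at_def by blast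
  have "infinite (polar G \<tau> M)"
  proof (rule infinite_polar[OF G m exp M(2)])
    fix F assume F: "finite F" "F \<subseteq> carrier G"
    \<comment> \<open>Shrinking \<open>U\<close> to the quasi-convex \<open>M\<close> preserves the
      failure of finite covers.\<close>
    have "F <#>\<^bsub>G\<^esub> M \<subseteq> F <#>\<^bsub>G\<^esub> U"
      using M(5) U(4) by (auto simp: set_mult_def)
    moreover have "F <#>\<^bsub>G\<^esub> U \<subseteq> carrier G"
      by (rule set_mult_closed[OF F(2) U(1)])
    ultimately show "F <#>\<^bsub>G\<^esub> M \<noteq> carrier G"
      using no_cover[OF F] by blast
  qed
  \<comment> \<open>Since \<open>x [^] m\<close> is the identity, exponents below \<open>m\<close>
    give all powers of \<open>x\<close>; the intersection is finite, hence open.\<close>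
  define W where "W = (\<Inter>k<m. {x \<in> topspace \<tau>. x [^]\<^bsub>G\<^esub> k \<in> V'})"
  have W: "openin \<tau> W" "\<one>\<^bsub>G\<^esub> \<in> W"
    using m openin_continuous_map_preimage[OF continuous_map_nat_pow[OF G gt] M(1)] M(3) top
    by (auto simp: W_def intro!: openin_INT2)
  have WG: "W \<subseteq> carrier G"
    using openin_subset[OF W(1)] top by simp
  have "polar G \<tau> M \<subseteq> annihilator G W"
    using M(4) by (intro polar_subset_annihilator[OF G m exp WG]) (auto simp: W_def)
  with \<open>infinite (polar G \<tau> M)\<close> have "infinite (annihilator G W)"
    using finite_subset by blast
  then have "(UNIV :: real set) \<lesssim> annihilator G W"
    by (intro reals_lepoll_annihilator[OF G m exp WG])
  \<comment> \<open>Openness of \<open>W\<close> is what makes all these homomorphisms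
    continuous.\<close>
  also have "annihilator G W \<lesssim> carrier (dual_group G \<tau>)"
    by (intro subset_imp_lepoll annihilator_subset_dual_group[OF G gt W])
  finally show ?thesis .
qed

end
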